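(* Let $\{u^1_h,u^2_h,u^3_h,u^4_h\}$ be a semi-discrete solution for some $T>0$. Then $$\max_{t\in S}\Big(\|u^1_h(t)\|_{\mathcal G_h}^2+\|u^2_h(t)\|_{\mathcal F_h}^2+\|u^3_h(t)\|_{\mathcal F_h}^2+\|u^4_h(t)\|_{\mathcal G_h}^2\Big)\le C,$$ $$\int_0^T\Big(\|\nabla_hu^1_h\|_{\mathcal E_h}^2+\|\nabla_{yh}u^2_h\|_{\mathcal H_h}^2+\|\nabla_{yh}u^3_h\|_{\mathcal H_h}^2\Big)\,\mathrm dt\le C,$$ where $C=\bar C\big(\|u^1_h(0)\|_{\mathcal G_h}^2+\|u^2_h(0)\|_{\mathcal F_h}^2+\|u^3_h(0)\|_{\mathcal F_h}^2+\|u^4_h(0)\|_{\mathcal G_h}^2\big)$ with $\bar C$ a positive constant independent of $h_x,h_y$.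
   Context: **Domains and data (standing assumptions).** $\Omega=(0,L)$, $Y=(0,\ell)$, $S=(0,T)$ with $L,\ell,T>0$. The subscript $+$ on $L^\infty$ denotes nonnegative functions. (A1) $d_1,d_2,d_3>0$, $Bi^M>0$, $H>0$, $u_1^D>0$ are constants. (A2) $\zeta(r,s)=\alpha r-\beta s$ with $\alpha,\beta\in L^\infty_+(Y)$ (in the discrete scheme, bounded representatives are evaluated at the nodes $y_j$). (A3) $\eta:\mathbb{R}^2\to[0,\infty)$ is given by $\eta(r,s)=kR(r)Q(s)$ if $r\ge 0$ and $s\ge 0$, and $\eta(r,s)=0$ otherwise, with $k>0$; $\eta$ is globally Lipschitz in both arguments; $R(r)\le r$ for all $r\in\mathbb{R}$; $Q\le\bar c$ for a constant $\bar c>0$; $R\in W^{1,\infty}(0,M_3)$ and $Q\in W^{1,\infty}(0,M_4)$ are monotone, $R$ strictly increasing, where $M_3,M_4$ are the $L^\infty$ bounds on the continuous unknowns $u_3$ and $u_4$ (positive constants). (A4) The original initial datum $U_1^0$ (for the unshifted macroscopic concentration) lies in $H^2(\Omega)\cap L^\infty_+(\Omega)$, $u_2^0,u_3^0\in L^2(\Omega;H^1(Y))\cap L^\infty_+(\Omega\times Y)$, $u_4^0\in H^1(\Omega)\cap L^\infty_+(\Omega)$. After the shift, $u_1^0:=U_1^0-u_1^D$. **Grids and operators.** For positive integers $N_x,N_y$ put $h_x=L/N_x$, $h_y=\ell/N_y$, $x_i=ih_x$, $y_j=jh_y$, $\Omega_h=\{x_i:0\le i\le N_x\}$, $\Omega_h^o=\{x_i:1\le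 i\le N_x\}$, $Y_h=\{y_j:0\le j\le N_y\}$, $\omega_h=\Omega_h\times Y_h$; $\mathcal G_h$ and $\mathcal F_h$ are the spaces of real functions on $\Omega_h$ and $\omega_h$, with $u_i=u_h(x_i)$, $u_{ij}=u_h(x_i,y_j)$. $\mathcal E_h$ is the space of real functions on the midpoints $x_{i+1/2}=(i+1/2)h_x$, $0\le i\le N_x-1$, and $\mathcal H_h$ that on points $(x_i,y_{j+1/2})$, $0\le i\le N_x$, $0\le j\le N_y-1$, $y_{j+1/2}=(j+1/2)h_y$. Put $(\nabla_hu_h)_{i+1/2}=(u_{i+1}-u_i)/h_x$, $(\nabla_{yh}u_h)_{i,j+1/2}=(u_{i,j+1}-u_{ij})/h_y$, $(\Delta_hu_h)_i=(u_{i-1}-2u_i+u_{i+1})/h_x^2$, $(\Delta_{yh}u_h)_{ij}=(u_{i,j-1}-2u_{ij}+u_{i,j+1})/h_y^2$. **Norms.** With $\gamma^1_i=1$ for $1\le i\le N_x-1$, $\gamma^1_0=\gamma^1_{N_x}=\frac12$, and $\gamma^2_j=1$ for $1\le j\le N_y-1$, $\gamma^2_0=\gamma^2_{N_y}=\frac12$: $\|u_h\|_{\mathcal G_h}^2=h_x\sum_{i=0}^{N_x}\gamma^1_iu_i^2$, $\|u_h\|_{\mathcal F_h}^2=h_xh_y\sum_{i=0}^{N_x}\sum_{j=0}^{N_y}\gamma^1_i\gamma^2_ju_{ij}^2$, $\|v_h\|_{\mathcal E_h}^2=h_x\sum_{i=0}^{N_x-1}v_{i+1/2}^2$, $\|v_h\|_{\mathcal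 H_h}^2=h_xh_y\sum_{i=0}^{N_x}\sum_{j=0}^{N_y-1}\gamma^1_iv_{i,j+1/2}^2$. **Semi-discrete solution.** A quadruple $u_h^1,u_h^4\in C^1([0,T];\mathcal G_h)$, $u_h^2,u_h^3\in C^1([0,T];\mathcal F_h)$ such that (superscripts number the species) $\dot u_h^1=d_1\Delta_hu_h^1-Bi^M(H(u_h^1+u_1^D)-u_h^2|_{y=0})$ on $\Omega_h^o$; $\dot u_h^2=d_2\Delta_{yh}u_h^2-\zeta(u_h^2,u_h^3)$ and $\dot u_h^3=d_3\Delta_{yh}u_h^3+\zeta(u_h^2,u_h^3)$ on $\omega_h$; $\dot u_h^4=\eta(u_h^3|_{y=\ell},u_h^4)$ on $\Omega_h$; where values outside the grid are defined by the discrete boundary conditions ($i=0,\dots,N_x$) $u^1_0=0$, $u^1_{N_x+1}=u^1_{N_x-1}$, $u^2_{i,-1}=u^2_{i,1}+\frac{2h_y}{d_2}Bi^M(H(u^1_i+u_1^D)-u^2_{i,0})$, $u^2_{i,N_y+1}=u^2_{i,N_y-1}$, $u^3_{i,-1}=u^3_{i,1}$, $u^3_{i,N_y+1}=u^3_{i,N_y-1}-\frac{2h_y}{d_3}\eta(u^3_{i,N_y},u^4_i)$; and $u_h^1(0)=\mathcal P_h^1u_1^0$, $u_h^2(0)=\mathcal P_h^2u_2^0$, $u_h^3(0)=\mathcal P_h^2u_3^0$, $u_h^4(0)=\mathcal P_h^1u_4^0$, where $\mathcal P_h^1,\mathcal P_h^2$ are suitable projection operators onto grid functions on $\Omega_h$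 and $\omega_h$ (compatible with $u_0^1=0$).
   Formalization: The initial discrete energy is assumed to be at least a fixed m > 0, and C̄ may depend on m; without this the claim fails: for U_1^0 = u_1^D and other data zero, C = 0, yet the derivative of u^1_h at t = 0 is −Bi^M H u_1^D ≠ 0. *)

theory Defs
  imports "HOL-Analysis.Analysis"
begin

section \<open>Function spaces\<close>

text \<open>Elements of the Lebesgue and Sobolev spaces are represented by functions; only their
  values almost everywhere on the given set matter.\<close>

definition L2_on :: "'a::euclidean_space set \<Rightarrow> ('a \<Rightarrow> real) \<Rightarrow> bool" where
  "L2_on S f \<longleftrightarrow>
     f \<in> borel_measurable (lebesgue_on S) \<and> integrable (lebesgue_on S) (\<lambda>x. (f x)\<^sup>2)"

definition Linf_on :: "'a::euclidean_space set \<Rightarrow> ('a \<Rightarrow> real) \<Rightarrow> bool" where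
  "Linf_on S f \<longleftrightarrow>
     f \<in> borel_measurable (lebesgue_on S) \<and> (\<exists>M. AE x in lebesgue_on S. \<bar>f x\<bar> \<le> M)"

definition Linf_plus_on :: "'a::euclidean_space set \<Rightarrow> ('a \<Rightarrow> real) \<Rightarrow> bool" where
  "Linf_plus_on S f \<longleftrightarrow> Linf_on S f \<and> (AE x in lebesgue_on S. 0 \<le> f x)"

definition test_fun :: "real set \<Rightarrow> (real \<Rightarrow> real) \<Rightarrow> bool" where
  "test_fun I \<phi> \<longleftrightarrow>
     (\<forall>n. (deriv ^^ n) \<phi> differentiable_on UNIV) \<and>
     compact (closure {x. \<phi> x \<noteq> 0}) \<and> closure {x. \<phi> x \<noteq> 0} \<subseteq> I"

text \<open>The next notion is only used for functions that are integrable on \<open>I\<close>.\<close>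

definition weak_deriv_on :: "real set \<Rightarrow> (real \<Rightarrow> real) \<Rightarrow> (real \<Rightarrow> real) \<Rightarrow> bool" where
  "weak_deriv_on I f g \<longleftrightarrow>
     (\<forall>\<phi>. test_fun I \<phi> \<longrightarrow>
        (LINT x|lebesgue_on I. f x * deriv \<phi> x) = - (LINT x|lebesgue_on I. g x * \<phi> x))"

definition H1_on :: "real set \<Rightarrow> (real \<Rightarrow> real) \<Rightarrow> bool" where
  "H1_on I f \<longleftrightarrow> L2_on I f \<and> (\<exists>g. L2_on I g \<and> weak_deriv_on I f g)"

definition H2_on :: "real set \<Rightarrow> (real \<Rightarrow> real) \<Rightarrow> bool" where
  "H2_on I f \<longleftrightarrow> L2_on I f \<and> (\<exists>g. H1_on I g \<and> weak_deriv_on I f g)"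

definition W1inf_on :: "real set \<Rightarrow> (real \<Rightarrow> real) \<Rightarrow> bool" where
  "W1inf_on I f \<longleftrightarrow> Linf_on I f \<and> (\<exists>g. Linf_on I g \<and> weak_deriv_on I f g)"

text \<open>The Bochner space \<open>L\<^sup>2(X; H\<^sup>1(Y))\<close>, under the usual identification of maps from \<open>X\<close> into
  functions on \<open>Y\<close> with functions on \<open>X \<times> Y\<close>; by Tonelli's theorem, square integrability of
  \<open>u\<close> and \<open>v\<close> on \<open>X \<times> Y\<close> means that the squared \<open>H\<^sup>1(Y)\<close>-norm of \<open>u (x, \<cdot>)\<close> is integrable in \<open>x\<close>.\<close>

definition L2_H1_on :: "real set \<Rightarrow> real set \<Rightarrow> (real \<times> real \<Rightarrow> real) \<Rightarrow> bool" where
  "L2_H1_on X Y u \<longleftrightarrow> L2_on (X \<times> Y) u \<and>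
     (\<exists>v. L2_on (X \<times> Y) v \<and>
          (AE x in lebesgue_on X. weak_deriv_on Y (\<lambda>y. u (x, y)) (\<lambda>y. v (x, y))))"


section \<open>Reaction rates and initial data\<close>

definition zeta :: "(real \<Rightarrow> real) \<Rightarrow> (real \<Rightarrow> real) \<Rightarrow> real \<Rightarrow> real \<Rightarrow> real \<Rightarrow> real" where
  "zeta \<alpha> \<beta> y r s = \<alpha> y * r - \<beta> y * s"

definition eta :: "real \<Rightarrow> (real \<Rightarrow> real) \<Rightarrow> (real \<Rightarrow> real) \<Rightarrow> real \<Rightarrow> real \<Rightarrow> real" where
  "eta k R Q r s = (if 0 \<le> r \<and> 0 \<le> s then k * R r * Q s else 0)"

definition initial_data ::
  "real \<Rightarrow> real \<Rightarrow> (real \<Rightarrow> real) \<Rightarrow> (real \<times> real \<Rightarrow> real) \<Rightarrow> (real \<times> real \<Rightarrow> real) \<Rightarrow>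
   (real \<Rightarrow> real) \<Rightarrow> bool" where
  "initial_data L l U10 u20 u30 u40 \<longleftrightarrow>
     H2_on {0<..<L} U10 \<and> Linf_plus_on {0<..<L} U10 \<and>
     L2_H1_on {0<..<L} {0<..<l} u20 \<and> Linf_plus_on ({0<..<L} \<times> {0<..<l}) u20 \<and>
     L2_H1_on {0<..<L} {0<..<l} u30 \<and> Linf_plus_on ({0<..<L} \<times> {0<..<l}) u30 \<and>
     H1_on {0<..<L} u40 \<and> Linf_plus_on {0<..<L} u40"


section \<open>Grid functions, difference operators and discrete norms\<close>

text \<open>A function on the nodes \<open>x\<^sub>i = i h\<close>, \<open>0 \<le> i \<le> N\<close>, is encoded by its index function
  \<open>int \<Rightarrow> real\<close>; integer indices make room for the ghost values at \<open>-1\<close> and \<open>N + 1\<close>. All other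
  indices are irrelevant. A function on the midpoints \<open>x\<^sub>i + h / 2\<close>, \<open>0 \<le> i \<le> N - 1\<close>, is indexed
  by \<open>i\<close>. Functions of two variables take the \<open>x\<close>-index first.\<close>

definition grad_h :: "real \<Rightarrow> (int \<Rightarrow> real) \<Rightarrow> int \<Rightarrow> real" where
  "grad_h h u i = (u (i + 1) - u i) / h"

definition grad_yh :: "real \<Rightarrow> (int \<Rightarrow> int \<Rightarrow> real) \<Rightarrow> int \<Rightarrow> int \<Rightarrow> real" where
  "grad_yh h u i j = (u i (j + 1) - u i j) / h"

definition lap_h :: "real \<Rightarrow> (int \<Rightarrow> real) \<Rightarrow> int \<Rightarrow> real" where
  "lap_h h u i = (u (i - 1) - 2 * u i + u (i + 1)) / h\<^sup>2"

definition lap_yh :: "real \<Rightarrow> (int \<Rightarrow> int \<Rightarrow> real) \<Rightarrow> int \<Rightarrow> int \<Rightarrow> real" where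
  "lap_yh h u i j = (u i (j - 1) - 2 * u i j + u i (j + 1)) / h\<^sup>2"

definition weight :: "nat \<Rightarrow> int \<Rightarrow> real" where
  "weight N i = (if i = 0 \<or> i = int N then 1 / 2 else 1)"

definition normsq_G :: "real \<Rightarrow> nat \<Rightarrow> (int \<Rightarrow> real) \<Rightarrow> real" where
  "normsq_G hx Nx u = hx * (\<Sum>i = 0..int Nx. weight Nx i * (u i)\<^sup>2)"

definition normsq_F :: "real \<Rightarrow> real \<Rightarrow> nat \<Rightarrow> nat \<Rightarrow> (int \<Rightarrow> int \<Rightarrow> real) \<Rightarrow> real" where
  "normsq_F hx hy Nx Ny u =
     hx * hy * (\<Sum>i = 0..int Nx. \<Sum>j = 0..int Ny. weight Nx i * weight Ny j * (u i j)\<^sup>2)"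

definition normsq_E :: "real \<Rightarrow> nat \<Rightarrow> (int \<Rightarrow> real) \<Rightarrow> real" where
  "normsq_E hx Nx v = hx * (\<Sum>i = 0..int Nx - 1. (v i)\<^sup>2)"

definition normsq_H :: "real \<Rightarrow> real \<Rightarrow> nat \<Rightarrow> nat \<Rightarrow> (int \<Rightarrow> int \<Rightarrow> real) \<Rightarrow> real" where
  "normsq_H hx hy Nx Ny v =
     hx * hy * (\<Sum>i = 0..int Nx. \<Sum>j = 0..int Ny - 1. weight Nx i * (v i j)\<^sup>2)"


section \<open>Semi-discrete solutions\<close>

definition C1_on_interval :: "real \<Rightarrow> (real \<Rightarrow> real) \<Rightarrow> bool" where
  "C1_on_interval T f \<longleftrightarrow>
     (\<exists>f'. (\<forall>t\<in>{0..T}. (f has_real_derivative f' t) (at t within {0..T})) \<and>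
           continuous_on {0..T} f')"

text \<open>\<open>\<eta>\<close> is the second reaction rate, and \<open>g1\<close>, \<dots>, \<open>g4\<close> are the grid functions prescribed at
  \<open>t = 0\<close>. The ghost values of \<open>u1\<close>, \<open>u2\<close>, \<open>u3\<close> are fixed by the boundary conditions.\<close>

definition semi_discrete_solution ::
  "real \<Rightarrow> real \<Rightarrow> real \<Rightarrow> real \<Rightarrow> real \<Rightarrow> real \<Rightarrow> real \<Rightarrow> real \<Rightarrow> real \<Rightarrow>
   (real \<Rightarrow> real) \<Rightarrow> (real \<Rightarrow> real) \<Rightarrow> (real \<Rightarrow> real \<Rightarrow> real) \<Rightarrow> nat \<Rightarrow> nat \<Rightarrow>
   (int \<Rightarrow> real) \<Rightarrow> (int \<Rightarrow> int \<Rightarrow> real) \<Rightarrow> (int \<Rightarrow> int \<Rightarrow> real) \<Rightarrow> (int \<Rightarrow> real) \<Rightarrow>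
   (real \<Rightarrow> int \<Rightarrow> real) \<Rightarrow> (real \<Rightarrow> int \<Rightarrow> int \<Rightarrow> real) \<Rightarrow>
   (real \<Rightarrow> int \<Rightarrow> int \<Rightarrow> real) \<Rightarrow> (real \<Rightarrow> int \<Rightarrow> real) \<Rightarrow> bool" where
  "semi_discrete_solution L l T d1 d2 d3 Bi H u1D \<alpha> \<beta> \<eta> Nx Ny g1 g2 g3 g4 u1 u2 u3 u4 \<longleftrightarrow>
   (let hx = L / real Nx; hy = l / real Ny; nx = int Nx; ny = int Ny in
     (\<forall>i\<in>{0..nx}.
        C1_on_interval T (\<lambda>t. u1 t i) \<and> C1_on_interval T (\<lambda>t. u4 t i) \<and>
        (\<forall>j\<in>{0..ny}. C1_on_interval T (\<lambda>t. u2 t i j) \<and> C1_on_interval T (\<lambda>t. u3 t i j))) \<and>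
     (\<forall>t\<in>{0..T}.
        (\<forall>i\<in>{1..nx}.
          ((\<lambda>s. u1 s i) has_real_derivative
             d1 * lap_h hx (u1 t) i - Bi * (H * (u1 t i + u1D) - u2 t i 0))
          (at t within {0..T})) \<and>
        (\<forall>i\<in>{0..nx}. \<forall>j\<in>{0..ny}.
          ((\<lambda>s. u2 s i j) has_real_derivative
             d2 * lap_yh hy (u2 t) i j - zeta \<alpha> \<beta> (of_int j * hy) (u2 t i j) (u3 t i j))
          (at t within {0..T}) \<and>
          ((\<lambda>s. u3 s i j) has_real_derivative
             d3 * lap_yh hy (u3 t) i j + zeta \<alpha> \<beta> (of_int j * hy) (u2 t i j) (u3 t i j))
          (at t within {0..T})) \<and>
        (\<forall>i\<in>{0..nx}.
          ((\<lambda>s. u4 s i) has_real_derivative \<eta> (u3 t i ny) (u4 t i)) (at t within {0..T})) \<and>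
        u1 t 0 = 0 \<and>
        u1 t (nx + 1) = u1 t (nx - 1) \<and>
        (\<forall>i\<in>{0..nx}.
          u2 t i (- 1) = u2 t i 1 + 2 * hy / d2 * (Bi * (H * (u1 t i + u1D) - u2 t i 0)) \<and>
          u2 t i (ny + 1) = u2 t i (ny - 1) \<and>
          u3 t i (- 1) = u3 t i 1 \<and>
          u3 t i (ny + 1) = u3 t i (ny - 1) - 2 * hy / d3 * \<eta> (u3 t i ny) (u4 t i))) \<and>
     (\<forall>i\<in>{0..nx}.
        u1 0 i = g1 i \<and> u4 0 i = g4 i \<and>
        (\<forall>j\<in>{0..ny}. u2 0 i j = g2 i j \<and> u3 0 i j = g3 i j)))"

definition total_normsq ::
  "real \<Rightarrow> real \<Rightarrow> nat \<Rightarrow> nat \<Rightarrow> (int \<Rightarrow> real) \<Rightarrow> (int \<Rightarrow> int \<Rightarrow> real) \<Rightarrow>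
   (int \<Rightarrow> int \<Rightarrow> real) \<Rightarrow> (int \<Rightarrow> real) \<Rightarrow> real" where
  "total_normsq hx hy Nx Ny v1 v2 v3 v4 =
     normsq_G hx Nx v1 + normsq_F hx hy Nx Ny v2 + normsq_F hx hy Nx Ny v3 + normsq_G hx Nx v4"

definition total_grad_normsq ::
  "real \<Rightarrow> real \<Rightarrow> nat \<Rightarrow> nat \<Rightarrow> (int \<Rightarrow> real) \<Rightarrow> (int \<Rightarrow> int \<Rightarrow> real) \<Rightarrow>
   (int \<Rightarrow> int \<Rightarrow> real) \<Rightarrow> real" where
  "total_grad_normsq hx hy Nx Ny v1 v2 v3 =
     normsq_E hx Nx (grad_h hx v1) + normsq_H hx hy Nx Ny (grad_yh hy v2) +
     normsq_H hx hy Nx Ny (grad_yh hy v3)"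

end

theory Submission
  imports Defs
begin

text \<open>Test each equation with its own unknown in the weighted grid inner products. Summation by
  parts turns the diffusion terms into minus the gradient norms plus boundary terms. At \<open>y = 0\<close>
  the exchange terms of \<open>u\<^sub>1\<close> and \<open>u\<^sub>2\<close> combine to
  \<open>Bi (H (u\<^sub>1 + u\<^sub>1\<^sup>D) - w) (w - u\<^sub>1)\<close> with \<open>w = u\<^sub>2|\<^bsub>y=0\<^esub>\<close>, where \<open>- w\<^sup>2\<close> absorbs all
  other occurrences of \<open>w\<close>, so that no trace inequality is needed. Since \<open>\<eta>\<close> vanishes for negative
  arguments, the boundary term of \<open>u\<^sub>3\<close> has a good sign, and \<open>\<eta> (r, s) \<le> K \<bar>s\<bar>\<close> with the Lipschitz
  constant \<open>K\<close>. Altogether \<open>E' + 2 d G \<le> a E + b\<close>, and Gronwall's argument applies; \<open>b\<close> is absorbed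
  using \<open>m \<le> E 0\<close>.\<close>

section \<open>Grid inner products and summation by parts\<close>

text \<open>The trapezoidal inner product that belongs to \<open>normsq_G\<close>. The half weights
  at the end nodes are what matches the centred ghost value conditions in the summation by
  parts.\<close>

definition inner_G :: "real \<Rightarrow> nat \<Rightarrow> (int \<Rightarrow> real) \<Rightarrow> (int \<Rightarrow> real) \<Rightarrow> real" where
  "inner_G h N u v = h * (\<Sum>i = 0..int N. weight N i * (u i * v i))"

lemma weight_nonneg: "0 \<le> weight N i"
  by (simp add: weight_def)

lemma normsq_G_nonneg: "0 \<le> h \<Longrightarrow> 0 \<le> normsq_G h N u"
  by (simp add: normsq_G_def sum_nonneg weight_nonneg)

lemma normsq_F_nonneg: "0 \<le> hx \<Longrightarrow> 0 \<le> hy \<Longrightarrow> 0 \<le> normsq_F hx hy Nx Ny u"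
  by (simp add: normsq_F_def sum_nonneg weight_nonneg)

lemma normsq_E_nonneg: "0 \<le> h \<Longrightarrow> 0 \<le> normsq_E h N u"
  by (simp add: normsq_E_def sum_nonneg)

lemma normsq_H_nonneg: "0 \<le> hx \<Longrightarrow> 0 \<le> hy \<Longrightarrow> 0 \<le> normsq_H hx hy Nx Ny u"
  by (simp add: normsq_H_def sum_nonneg weight_nonneg)

text \<open>Species 2 and 3 diffuse in y only, so two-dimensional quantities are treated column by
  column with one-dimensional lemmas.\<close>

lemma normsq_F_columns:
  "normsq_F hx hy Nx Ny u = hx * (\<Sum>i = 0..int Nx. weight Nx i * normsq_G hy Ny (u i))"
  by (simp add: normsq_F_def normsq_G_def sum_distrib_left mult_ac)

lemma normsq_H_columns:
  "normsq_H hx hy Nx Ny v = hx * (\<Sum>i = 0..int Nx. weight Nx i * normsq_E hy Ny (v i))"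
  by (simp add: normsq_H_def normsq_E_def sum_distrib_left mult_ac)

lemma grad_yh_column: "grad_yh h u i = grad_h h (u i)"
  by (simp add: fun_eq_iff grad_yh_def grad_h_def)

lemma lap_yh_column: "lap_yh h u i = lap_h h (u i)"
  by (simp add: fun_eq_iff lap_yh_def lap_h_def)

lemma inner_G_add_right: "inner_G h N u (\<lambda>i. v i + w i) = inner_G h N u v + inner_G h N u w"
  by (simp add: inner_G_def algebra_simps sum.distrib)

lemma inner_G_scale_right: "inner_G h N u (\<lambda>i. c * v i) = c * inner_G h N u v"
  by (simp add: inner_G_def sum_distrib_left mult_ac)

lemma atLeastAtMost_int_Suc: "{0..int (Suc n)} = insert (int (Suc n)) {0..int n}"
  by auto

text \<open>\<open>0 < N\<close> keeps the two end nodes distinct, so that each loses exactly one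
  half.\<close>

lemma sum_weight:
  assumes "0 < N"
  shows "(\<Sum>i = 0..int N. weight N i * f i) = (\<Sum>i = 0..int N. f i) - (f 0 + f (int N)) / 2"
proof -
  have "(\<Sum>i = 0..int N. weight N i * f i)
      = (\<Sum>i = 0..int N. f i - ((if i = 0 then f i / 2 else 0) + (if i = int N then f i / 2 else 0)))"
    using assms by (intro sum.cong) (auto simp: weight_def)
  also have "\<dots> = (\<Sum>i = 0..int N. f i) - (f 0 / 2 + f (int N) / 2)"
    by (simp add: sum_subtractf sum.distrib)
  finally show ?thesis by (simp add: field_simps)
qed

lemma sum_weight_eq: "0 < N \<Longrightarrow> (\<Sum>i = 0..int N. weight N i) = real N"
  using sum_weight[of N "\<lambda>_. 1"] by simp

text \<open>No boundary condition enters: the ghost values survive in one-sided differences at both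
  ends. In the induction, the old right end term and the product at the new node combine to a new
  square and the new end term.\<close>

lemma sum_second_difference:
  fixes u :: "int \<Rightarrow> real"
  shows "(\<Sum>i = 0..int N. u i * (u (i - 1) - 2 * u i + u (i + 1)))
    = - (\<Sum>i = 0..int N - 1. (u (i + 1) - u i)\<^sup>2)
      + u 0 * (u (- 1) - u 0) + u (int N) * (u (int N + 1) - u (int N))"
proof (induction N)
  case 0
  show ?case by (simp add: algebra_simps)
next
  case (Suc N)
  have "{0..int (Suc N) - 1} = insert (int N) {0..int N - 1}" by auto
  then have "(\<Sum>i = 0..int (Suc N) - 1. (u (i + 1) - u i)\<^sup>2)
      = (u (int N + 1) - u (int N))\<^sup>2 + (\<Sum>i = 0..int N - 1. (u (i + 1) - u i)\<^sup>2)"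
    by simp
  then show ?case
    unfolding atLeastAtMost_int_Suc using Suc
    by (simp add: power2_eq_square algebra_simps)
qed

text \<open>Subtracting half of the end products turns the one-sided differences of the unweighted
  identity into centred ones, the very quantities that the discrete boundary conditions
  prescribe.\<close>

lemma inner_G_lap_h:
  assumes "0 < N" and "h \<noteq> 0"
  shows "inner_G h N u (lap_h h u) = - normsq_E h N (grad_h h u)
    + (u 0 * (u (- 1) - u 1) + u (int N) * (u (int N + 1) - u (int N - 1))) / (2 * h)"
proof -
  let ?S = "\<Sum>i = 0..int N - 1. (u (i + 1) - u i)\<^sup>2"
  let ?d = "\<lambda>i. u i * (u (i - 1) - 2 * u i + u (i + 1))"
  have "inner_G h N u (lap_h h u) = h * ((\<Sum>i = 0..int N. weight N i * ?d i) / h\<^sup>2)"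
    by (simp add: inner_G_def lap_h_def sum_divide_distrib)
  also have "(\<Sum>i = 0..int N. weight N i * ?d i)
      = - ?S + (u 0 * (u (- 1) - u 1) + u (int N) * (u (int N + 1) - u (int N - 1))) / 2"
    unfolding sum_weight[OF assms(1)] sum_second_difference by (simp add: field_simps)
  finally have *: "inner_G h N u (lap_h h u) = h * ((- ?S
      + (u 0 * (u (- 1) - u 1) + u (int N) * (u (int N + 1) - u (int N - 1))) / 2) / h\<^sup>2)" .
  have "normsq_E h N (grad_h h u) = h * (?S / h\<^sup>2)"
    by (simp add: normsq_E_def grad_h_def power_divide sum_divide_distrib)
  moreover have "h * ((- s + b / 2) / h\<^sup>2) = - (h * (s / h\<^sup>2)) + b / (2 * h)" for s b
    using assms(2) by (simp add: field_simps power2_eq_square)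
  ultimately show ?thesis using * by presburger
qed

section \<open>Time derivatives and continuity of the norms\<close>

lemma has_derivative_normsq_G:
  assumes "\<And>i. i \<in> {0..int N} \<Longrightarrow> ((\<lambda>s. u s i) has_real_derivative u' i) (at t within S)"
  shows "((\<lambda>s. normsq_G h N (u s)) has_real_derivative 2 * inner_G h N (u t) u') (at t within S)"
  unfolding normsq_G_def
  by (rule derivative_eq_intros assms refl | assumption)+
     (simp add: inner_G_def sum_distrib_left mult_ac)

lemma has_derivative_normsq_F:
  assumes "\<And>i j. i \<in> {0..int Nx} \<Longrightarrow> j \<in> {0..int Ny} \<Longrightarrow>
    ((\<lambda>s. u s i j) has_real_derivative u' i j) (at t within S)"
  shows "((\<lambda>s. normsq_F hx hy Nx Ny (u s)) has_real_derivative
    hx * (\<Sum>i = 0..int Nx. weight Nx i * (2 * inner_G hy Ny (u t i) (u' i)))) (at t within S)"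
  unfolding normsq_F_columns
  by (intro DERIV_cmult DERIV_sum has_derivative_normsq_G assms)

lemma continuous_on_normsq_E_grad_h:
  assumes "\<And>i. i \<in> {0..int N} \<Longrightarrow> continuous_on S (\<lambda>s. u s i)"
  shows "continuous_on S (\<lambda>s. normsq_E h N (grad_h h (u s)))"
  unfolding normsq_E_def grad_h_def divide_inverse
  by (intro continuous_intros assms) auto

lemma continuous_on_normsq_H_grad_yh:
  assumes "\<And>i j. i \<in> {0..int Nx} \<Longrightarrow> j \<in> {0..int Ny} \<Longrightarrow> continuous_on S (\<lambda>s. u s i j)"
  shows "continuous_on S (\<lambda>s. normsq_H hx hy Nx Ny (grad_yh hy (u s)))"
  unfolding normsq_H_def grad_yh_def divide_inverse
  by (intro continuous_intros assms) auto

section \<open>The dissipation inequality\<close>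

text \<open>The definition of \<open>eta\<close> makes it vanish for s < 0 but not visibly at s = 0.
  Hence (r, s) is compared with (r, -e), and e tends to 0.\<close>

lemma eta_le_Lipschitz:
  assumes lip: "K-lipschitz_on UNIV (\<lambda>(r, s). eta k R Q r s)"
  shows "eta k R Q r s \<le> K * \<bar>s\<bar>"
proof -
  have K: "0 \<le> K" using lip by (rule lipschitz_on_nonneg)
  have "eta k R Q r s \<le> K * \<bar>s\<bar> + K * e" if "0 < e" for e
  proof (cases "0 \<le> s")
    case True
    have "dist (eta k R Q r s) (eta k R Q r (- e)) \<le> K * dist (r, s) (r, - e)"
      using lipschitz_onD[OF lip, of "(r, s)" "(r, - e)"] by simp
    moreover have "eta k R Q r (- e) = 0" using that by (simp add: eta_def)
    ultimately show ?thesis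
      using that True by (simp add: dist_Pair_Pair dist_real_def algebra_simps)
  next
    case False
    moreover have "0 \<le> K * \<bar>s\<bar>" "0 \<le> K * e" using K that by simp_all
    ultimately show ?thesis by (simp add: eta_def)
  qed
  \<comment> \<open>Dividing by \<open>K + 1\<close> instead of \<open>K\<close> covers K =
    0.\<close>
  from this[of "e / (K + 1)" for e] have *: "eta k R Q r s \<le> K * \<bar>s\<bar> + K * (e / (K + 1))"
    if "0 < e" for e using that K by simp
  show ?thesis
  proof (rule field_le_epsilon)
    fix e :: real assume e: "0 < e"
    have "K * (e / (K + 1)) \<le> e" using K e by (simp add: field_simps)
    with *[OF e] show "eta k R Q r s \<le> K * \<bar>s\<bar> + e" by linarith
  qed
qed

text \<open>Expanded, the left side contains \<open>- 2 * w\<^sup>2\<close>. One copy of the square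
  is completed with \<open>(H + 1) * u\<close>, the other with \<open>H * p\<close>; the bound is
  therefore free of the boundary value w.\<close>

lemma exchange_term_bound:
  fixes H p u w :: real
  assumes "0 \<le> H"
  shows "2 * ((H * (u + p) - w) * (w - u)) \<le> (H + 1)\<^sup>2 * u\<^sup>2 + (H\<^sup>2 + H) * p\<^sup>2"
proof -
  have "(H + 1)\<^sup>2 * u\<^sup>2 + (H\<^sup>2 + H) * p\<^sup>2 - 2 * ((H * (u + p) - w) * (w - u))
      = ((H + 1) * u - w)\<^sup>2 + (H * p - w)\<^sup>2 + H * ((p + u)\<^sup>2 + u\<^sup>2)"
    by (simp add: power2_eq_square algebra_simps)
  moreover have "0 \<le> H * ((p + u)\<^sup>2 + u\<^sup>2)" using assms by simp
  ultimately show ?thesis by (smt (verit) zero_le_power2)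
qed

text \<open>Both factors are estimated through \<bar>r\<bar> + \<bar>s\<bar>. The 4 is the outer 2
  times the 2 from bounding the square of this sum by the sum of squares.\<close>

lemma reaction_term_bound:
  fixes a b r s A :: real
  assumes "\<bar>a\<bar> \<le> A" "\<bar>b\<bar> \<le> A"
  shows "2 * ((a * r - b * s) * (s - r)) \<le> 4 * A * (r\<^sup>2 + s\<^sup>2)"
proof -
  have "(a * r - b * s) * (s - r) \<le> \<bar>a * r - b * s\<bar> * \<bar>s - r\<bar>"
    by (metis abs_ge_self abs_mult)
  also have "\<bar>a * r - b * s\<bar> \<le> A * (\<bar>r\<bar> + \<bar>s\<bar>)"
  proof -
    have "\<bar>a * r\<bar> \<le> A * \<bar>r\<bar>" "\<bar>b * s\<bar> \<le> A * \<bar>s\<bar>"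
      using assms by (simp_all add: abs_mult mult_right_mono)
    then show ?thesis by (simp add: distrib_left)
  qed
  then have "\<bar>a * r - b * s\<bar> * \<bar>s - r\<bar> \<le> (A * (\<bar>r\<bar> + \<bar>s\<bar>)) * (\<bar>r\<bar> + \<bar>s\<bar>)"
    using assms by (intro mult_mono) auto
  also have "\<dots> = A * (\<bar>r\<bar> + \<bar>s\<bar>)\<^sup>2" by (simp add: power2_eq_square)
  also have "\<dots> \<le> A * (2 * (r\<^sup>2 + s\<^sup>2))"
  proof (rule mult_left_mono)
    have "0 \<le> (\<bar>r\<bar> - \<bar>s\<bar>)\<^sup>2" by simp
    then show "(\<bar>r\<bar> + \<bar>s\<bar>)\<^sup>2 \<le> 2 * (r\<^sup>2 + s\<^sup>2)" by (simp add: power2_sum power2_diff)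
    show "0 \<le> A" using assms by linarith
  qed
  finally show ?thesis by (simp add: algebra_simps)
qed

text \<open>The reaction enters the two species with opposite signs, so their contributions merge
  into one product with w - v at each node.\<close>

lemma zeta_terms_bound:
  assumes "0 \<le> h" and "\<And>j. j \<in> {0..int N} \<Longrightarrow> \<bar>\<alpha> (of_int j * h)\<bar> \<le> A \<and> \<bar>\<beta> (of_int j * h)\<bar> \<le> A"
  shows "2 * inner_G h N v (\<lambda>j. - zeta \<alpha> \<beta> (of_int j * h) (v j) (w j))
    + 2 * inner_G h N w (\<lambda>j. zeta \<alpha> \<beta> (of_int j * h) (v j) (w j))
    \<le> 4 * A * (normsq_G h N v + normsq_G h N w)"
proof -
  let ?z = "\<lambda>j. zeta \<alpha> \<beta> (of_int j * h) (v j) (w j)"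
  have "2 * inner_G h N v (\<lambda>j. - ?z j) + 2 * inner_G h N w ?z
      = h * (\<Sum>j = 0..int N. weight N j * (2 * (?z j * (w j - v j))))"
    by (simp add: inner_G_def sum_distrib_left sum.distrib[symmetric] algebra_simps)
  also have "\<dots> \<le> h * (\<Sum>j = 0..int N. weight N j * (4 * A * ((v j)\<^sup>2 + (w j)\<^sup>2)))"
    unfolding zeta_def using assms
    by (intro mult_left_mono sum_mono reaction_term_bound weight_nonneg) auto
  also have "\<dots> = 4 * A * (normsq_G h N v + normsq_G h N w)"
    by (simp add: normsq_G_def sum_distrib_left sum.distrib[symmetric] algebra_simps)
  finally show ?thesis .
qed

text \<open>Here f is the flux entering v at y = 0 and g the flux leaving w at the other end. The
  factors 2h / d in the ghost values cancel d and 1 / (2h) from the summation by parts, leaving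
  boundary terms without any power of h.\<close>

lemma column_dissipation:
  assumes h: "0 < h" and N: "0 < N" and d: "0 < d2" "0 < d3"
    and coeffs: "\<And>j. j \<in> {0..int N} \<Longrightarrow> \<bar>\<alpha> (of_int j * h)\<bar> \<le> A \<and> \<bar>\<beta> (of_int j * h)\<bar> \<le> A"
    and v: "v (- 1) = v 1 + 2 * h / d2 * f" "v (int N + 1) = v (int N - 1)"
    and w: "w (- 1) = w 1" "w (int N + 1) = w (int N - 1) - 2 * h / d3 * g"
  shows "2 * inner_G h N v (\<lambda>j. d2 * lap_h h v j - zeta \<alpha> \<beta> (of_int j * h) (v j) (w j))
    + 2 * inner_G h N w (\<lambda>j. d3 * lap_h h w j + zeta \<alpha> \<beta> (of_int j * h) (v j) (w j))
    \<le> 4 * A * (normsq_G h N v + normsq_G h N w)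
      - 2 * d2 * normsq_E h N (grad_h h v) - 2 * d3 * normsq_E h N (grad_h h w)
      + 2 * (f * v 0) - 2 * (g * w (int N))"
proof -
  let ?z = "\<lambda>j. zeta \<alpha> \<beta> (of_int j * h) (v j) (w j)"
  have "d2 * inner_G h N v (lap_h h v) = - d2 * normsq_E h N (grad_h h v) + f * v 0"
    unfolding inner_G_lap_h[OF N less_imp_neq[OF h, symmetric]] v using h d by (simp add: field_simps)
  moreover have "d3 * inner_G h N w (lap_h h w) = - d3 * normsq_E h N (grad_h h w) - g * w (int N)"
    unfolding inner_G_lap_h[OF N less_imp_neq[OF h, symmetric]] w using h d by (simp add: field_simps)
  moreover have "inner_G h N v (\<lambda>j. d2 * lap_h h v j - ?z j)
      = d2 * inner_G h N v (lap_h h v) + inner_G h N v (\<lambda>j. - ?z j)"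
    using inner_G_add_right[of h N v "\<lambda>j. d2 * lap_h h v j" "\<lambda>j. - ?z j"]
    by (simp add: inner_G_scale_right)
  moreover have "inner_G h N w (\<lambda>j. d3 * lap_h h w j + ?z j)
      = d3 * inner_G h N w (lap_h h w) + inner_G h N w ?z"
    by (simp add: inner_G_add_right inner_G_scale_right)
  ultimately show ?thesis
    using zeta_terms_bound[of h N \<alpha> A \<beta> v w] h coeffs by (simp add: algebra_simps)
qed

text \<open>The left side is the time derivative of the energy, but the claim is purely algebraic in
  the grid values at one instant. Everything is estimated on a single column first and summed over i
  afterwards. \<open>D1\<close> is 0 at the Dirichlet node, where u1 is pinned.\<close>

lemma energy_dissipation:
  fixes u1 u4 :: "int \<Rightarrow> real" and u2 u3 :: "int \<Rightarrow> int \<Rightarrow> real"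
    and d1 d2 d3 hx hy Bi H p :: real and \<alpha> \<beta> :: "real \<Rightarrow> real" and \<eta> :: "real \<Rightarrow> real \<Rightarrow> real"
    and Ny :: nat
  defines "D1 \<equiv> \<lambda>i. if i = 0 then 0
      else d1 * lap_h hx u1 i - Bi * (H * (u1 i + p) - u2 i 0)"
    and "D2 \<equiv> \<lambda>i j. d2 * lap_yh hy u2 i j - zeta \<alpha> \<beta> (of_int j * hy) (u2 i j) (u3 i j)"
    and "D3 \<equiv> \<lambda>i j. d3 * lap_yh hy u3 i j + zeta \<alpha> \<beta> (of_int j * hy) (u2 i j) (u3 i j)"
    and "D4 \<equiv> \<lambda>i. \<eta> (u3 i (int Ny)) (u4 i)"
  assumes h: "0 < hx" "0 < hy" and N: "0 < Nx" "0 < Ny"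
    and d: "0 < d" "d \<le> d1" "d \<le> d2" "d \<le> d3" and Bi: "0 < Bi" and H: "0 < H"
    and K: "0 \<le> K" and \<eta>: "\<And>r s. 0 \<le> \<eta> r s" "\<And>r s. r < 0 \<or> s < 0 \<Longrightarrow> \<eta> r s = 0"
      "\<And>r s. \<eta> r s \<le> K * \<bar>s\<bar>"
    and coeffs: "\<And>j. j \<in> {0..int Ny} \<Longrightarrow> \<bar>\<alpha> (of_int j * hy)\<bar> \<le> A \<and> \<bar>\<beta> (of_int j * hy)\<bar> \<le> A"
    and bc1: "u1 0 = 0" "u1 (int Nx + 1) = u1 (int Nx - 1)"
    and bc2: "\<And>i. i \<in> {0..int Nx} \<Longrightarrow>
        u2 i (- 1) = u2 i 1 + 2 * hy / d2 * (Bi * (H * (u1 i + p) - u2 i 0))"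
      "\<And>i. i \<in> {0..int Nx} \<Longrightarrow> u2 i (int Ny + 1) = u2 i (int Ny - 1)"
    and bc3: "\<And>i. i \<in> {0..int Nx} \<Longrightarrow> u3 i (- 1) = u3 i 1"
      "\<And>i. i \<in> {0..int Nx} \<Longrightarrow>
        u3 i (int Ny + 1) = u3 i (int Ny - 1) - 2 * hy / d3 * \<eta> (u3 i (int Ny)) (u4 i)"
  shows "2 * inner_G hx Nx u1 D1
      + hx * (\<Sum>i = 0..int Nx. weight Nx i * (2 * inner_G hy Ny (u2 i) (D2 i)))
      + hx * (\<Sum>i = 0..int Nx. weight Nx i * (2 * inner_G hy Ny (u3 i) (D3 i)))
      + 2 * inner_G hx Nx u4 D4
    \<le> (Bi * (H + 1)\<^sup>2 + 4 * A + 2 * K) * total_normsq hx hy Nx Ny u1 u2 u3 u4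
      + hx * real Nx * (Bi * ((H\<^sup>2 + H) * p\<^sup>2))
      - 2 * d * total_grad_normsq hx hy Nx Ny u1 u2 u3"
proof -
  define a where "a = Bi * (H + 1)\<^sup>2 + 4 * A + 2 * K"
  define b where "b = Bi * ((H\<^sup>2 + H) * p\<^sup>2)"
  define e where "e i = (u1 i)\<^sup>2 + normsq_G hy Ny (u2 i) + normsq_G hy Ny (u3 i) + (u4 i)\<^sup>2" for i
  define g where "g i = normsq_E hy Ny (grad_h hy (u2 i)) + normsq_E hy Ny (grad_h hy (u3 i))" for i
  define r where "r i = 2 * (u1 i * D1 i) + 2 * inner_G hy Ny (u2 i) (D2 i)
      + 2 * inner_G hy Ny (u3 i) (D3 i) + 2 * (u4 i * D4 i)" for i
  have A: "0 \<le> A" using coeffs[of 0] by force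
  \<comment> \<open>The x-diffusion is carried along exactly: it gets a sign only after summation
    over i.\<close>
  have r_le: "r i \<le> a * e i + b - 2 * d * g i + 2 * d1 * (u1 i * lap_h hx u1 i)"
    if i: "i \<in> {0..int Nx}" for i
  proof -
    let ?f = "Bi * (H * (u1 i + p) - u2 i 0)"
    \<comment> \<open>At i = 0 both sides vanish because u1 does, so this node needs no separate
      treatment.\<close>
    have D1: "u1 i * D1 i = d1 * (u1 i * lap_h hx u1 i) - ?f * u1 i"
      using bc1(1) by (simp add: D1_def algebra_simps)
    have "2 * inner_G hy Ny (u2 i) (D2 i) + 2 * inner_G hy Ny (u3 i) (D3 i)
      \<le> 4 * A * (normsq_G hy Ny (u2 i) + normsq_G hy Ny (u3 i))
        - 2 * d2 * normsq_E hy Ny (grad_h hy (u2 i)) - 2 * d3 * normsq_E hy Ny (grad_h hy (u3 i))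
        + 2 * (?f * u2 i 0) - 2 * (D4 i * u3 i (int Ny))"
      using column_dissipation[OF h(2) N(2), of d2 d3 \<alpha> A \<beta> "u2 i" ?f "u3 i" "D4 i"]
        d coeffs bc2[OF i] bc3[OF i]
      by (simp add: D2_def D3_def D4_def lap_yh_column)
    moreover have "d * normsq_E hy Ny (grad_h hy (u2 i)) \<le> d2 * normsq_E hy Ny (grad_h hy (u2 i))"
      "d * normsq_E hy Ny (grad_h hy (u3 i)) \<le> d3 * normsq_E hy Ny (grad_h hy (u3 i))"
      using d h by (simp_all add: mult_right_mono normsq_E_nonneg)
    \<comment> \<open>Either u3 is negative and the rate is zero, or both factors are
      nonnegative.\<close>
    moreover have "0 \<le> D4 i * u3 i (int Ny)"
      unfolding D4_def using \<eta>(1)[of "u3 i (int Ny)" "u4 i"] \<eta>(2)[of "u3 i (int Ny)" "u4 i"]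
      by (cases "u3 i (int Ny) < 0") auto
    moreover have "u4 i * D4 i \<le> K * (u4 i)\<^sup>2"
    proof -
      have "u4 i * D4 i \<le> \<bar>u4 i\<bar> * D4 i"
        unfolding D4_def using \<eta>(1) by (intro mult_right_mono) auto
      also have "\<dots> \<le> \<bar>u4 i\<bar> * (K * \<bar>u4 i\<bar>)"
        unfolding D4_def using \<eta>(3) by (intro mult_left_mono) auto
      finally show ?thesis by (simp add: power2_eq_square mult.left_commute)
    qed
    \<comment> \<open>The flux from the ghost value of u2 meets the exchange term of u1.\<close>
    moreover have "2 * (?f * u2 i 0) - 2 * (?f * u1 i) \<le> Bi * ((H + 1)\<^sup>2 * (u1 i)\<^sup>2) + b"
      using mult_left_mono[OF exchange_term_bound[of H "u1 i" p "u2 i 0"], of Bi] H Bi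
      unfolding b_def by (simp add: algebra_simps)
    ultimately have "r i \<le> Bi * (H + 1)\<^sup>2 * (u1 i)\<^sup>2
        + 4 * A * (normsq_G hy Ny (u2 i) + normsq_G hy Ny (u3 i)) + 2 * K * (u4 i)\<^sup>2
        + b - 2 * d * g i + 2 * d1 * (u1 i * lap_h hx u1 i)"
      unfolding r_def g_def D1 by (simp add: algebra_simps)
    also have "Bi * (H + 1)\<^sup>2 * (u1 i)\<^sup>2
        + 4 * A * (normsq_G hy Ny (u2 i) + normsq_G hy Ny (u3 i)) + 2 * K * (u4 i)\<^sup>2
      \<le> a * (u1 i)\<^sup>2 + a * (normsq_G hy Ny (u2 i) + normsq_G hy Ny (u3 i)) + a * (u4 i)\<^sup>2"
      unfolding a_def using A K Bi h
      by (intro add_mono mult_right_mono) (auto simp: normsq_G_nonneg)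
    finally show ?thesis unfolding e_def by (simp add: algebra_simps)
  qed
  have "2 * inner_G hx Nx u1 D1
      + hx * (\<Sum>i = 0..int Nx. weight Nx i * (2 * inner_G hy Ny (u2 i) (D2 i)))
      + hx * (\<Sum>i = 0..int Nx. weight Nx i * (2 * inner_G hy Ny (u3 i) (D3 i)))
      + 2 * inner_G hx Nx u4 D4
    = hx * (\<Sum>i = 0..int Nx. weight Nx i * r i)"
    unfolding r_def inner_G_def[of hx]
    by (simp add: sum.distrib distrib_left sum_distrib_left mult_ac)
  also have "\<dots> \<le> hx * (\<Sum>i = 0..int Nx. weight Nx i *
      (a * e i + b - 2 * d * g i + 2 * d1 * (u1 i * lap_h hx u1 i)))"
    using h r_le by (intro mult_left_mono sum_mono weight_nonneg) auto
  also have "\<dots> = a * (hx * (\<Sum>i = 0..int Nx. weight Nx i * e i))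
      + hx * (\<Sum>i = 0..int Nx. weight Nx i) * b
      - 2 * d * (hx * (\<Sum>i = 0..int Nx. weight Nx i * g i))
      + 2 * d1 * inner_G hx Nx u1 (lap_h hx u1)"
    unfolding inner_G_def
    by (simp add: sum.distrib sum_subtractf distrib_left right_diff_distrib sum_distrib_left
        sum_distrib_right mult_ac)
  also have "hx * (\<Sum>i = 0..int Nx. weight Nx i * e i) = total_normsq hx hy Nx Ny u1 u2 u3 u4"
    unfolding total_normsq_def normsq_F_columns normsq_G_def[of hx] e_def
    by (simp add: sum.distrib distrib_left)
  also have "hx * (\<Sum>i = 0..int Nx. weight Nx i * g i)
      = normsq_H hx hy Nx Ny (grad_yh hy u2) + normsq_H hx hy Nx Ny (grad_yh hy u3)"
    unfolding normsq_H_columns g_def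
    by (simp add: sum.distrib distrib_left grad_yh_column)
  \<comment> \<open>The left boundary term vanishes since u1 is 0 there, the right one by the
    mirrored ghost value.\<close>
  also have "inner_G hx Nx u1 (lap_h hx u1) = - normsq_E hx Nx (grad_h hx u1)"
    using inner_G_lap_h[OF N(1), of hx u1] h bc1 by simp
  finally have "2 * inner_G hx Nx u1 D1
      + hx * (\<Sum>i = 0..int Nx. weight Nx i * (2 * inner_G hy Ny (u2 i) (D2 i)))
      + hx * (\<Sum>i = 0..int Nx. weight Nx i * (2 * inner_G hy Ny (u3 i) (D3 i)))
      + 2 * inner_G hx Nx u4 D4
    \<le> a * total_normsq hx hy Nx Ny u1 u2 u3 u4 + hx * real Nx * b
      - 2 * d * (normsq_H hx hy Nx Ny (grad_yh hy u2) + normsq_H hx hy Nx Ny (grad_yh hy u3))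
      - 2 * d1 * normsq_E hx Nx (grad_h hx u1)"
    unfolding sum_weight_eq[OF N(1)] by simp
  moreover have "d * normsq_E hx Nx (grad_h hx u1) \<le> d1 * normsq_E hx Nx (grad_h hx u1)"
    using d h by (simp add: mult_right_mono normsq_E_nonneg)
  ultimately show ?thesis
    unfolding a_def[symmetric] b_def[symmetric] total_grad_normsq_def
    by (simp add: algebra_simps)
qed

section \<open>Gronwall's argument\<close>

text \<open>The shift by b / a absorbs the constant b, and the factor exp(-a t) absorbs a E. The
  resulting F is nonincreasing, and its total decrease, at most F 0, also pays for the integral of
  G.\<close>

lemma Gronwall_with_dissipation:
  fixes E E' G :: "real \<Rightarrow> real"
  assumes T: "0 < T" and a: "0 < a" and b: "0 \<le> b" and c: "0 < c"
    and E': "\<And>t. t \<in> {0..T} \<Longrightarrow> (E has_real_derivative E' t) (at t within {0..T})"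
    and E_nonneg: "\<And>t. t \<in> {0..T} \<Longrightarrow> 0 \<le> E t"
    and G_nonneg: "\<And>t. t \<in> {0..T} \<Longrightarrow> 0 \<le> G t"
    and G_int: "G integrable_on {0..T}"
    and le: "\<And>t. t \<in> {0..T} \<Longrightarrow> E' t \<le> a * E t + b - c * G t"
  shows "t \<in> {0..T} \<Longrightarrow> E t \<le> exp (a * T) * (E 0 + b / a)"
    and "integral {0..T} G \<le> exp (a * T) / c * (E 0 + b / a)"
proof -
  define F where "F t = exp (- a * t) * (E t + b / a)" for t
  define F' where "F' t = exp (- a * t) * (E' t - a * E t - b)" for t
  have F': "(F has_real_derivative F' t) (at t within {0..T})" if "t \<in> {0..T}" for t
    unfolding F_def F'_def
    by (rule derivative_eq_intros E' that refl)+ (use a in \<open>simp add: field_simps\<close>)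
  \<comment> \<open>As G is nonnegative, exp(-a t) may be lowered to its value at T, a constant that
    leaves the integral.\<close>
  have F'_le: "c * exp (- a * T) * G t \<le> - F' t" if "t \<in> {0..T}" for t
  proof -
    have "exp (- a * T) * (c * G t) \<le> exp (- a * t) * (c * G t)"
      using that a c G_nonneg[OF that] by (intro mult_right_mono) auto
    also have "\<dots> \<le> exp (- a * t) * (a * E t + b - E' t)"
      using le[OF that] by (intro mult_left_mono) auto
    finally show ?thesis by (simp add: F'_def algebra_simps)
  qed
  \<comment> \<open>Being an exact derivative, \<open>F'\<close> is integrable with no continuity
    required of \<open>E'\<close>.\<close>
  have FTC: "(F' has_integral (F t - F 0)) {0..t}" if "t \<in> {0..T}" for t
  proof (rule fundamental_theorem_of_calculus)
    show "0 \<le> t" using that by simp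
    fix s assume "s \<in> {0..t}"
    with that have "(F has_real_derivative F' s) (at s within {0..t})"
      by (intro DERIV_subset[OF F']) auto
    then show "(F has_vector_derivative F' s) (at s within {0..t})"
      by (simp add: has_real_derivative_iff_has_vector_derivative)
  qed
  have F_nonneg: "0 \<le> F t" if "t \<in> {0..T}" for t
    using that a b E_nonneg by (simp add: F_def)
  have F0: "F 0 = E 0 + b / a" by (simp add: F_def)
  show "E t \<le> exp (a * T) * (E 0 + b / a)" if t: "t \<in> {0..T}"
  proof -
    have "0 \<le> - (F t - F 0)"
    proof (rule has_integral_nonneg[OF has_integral_neg[OF FTC[OF t]]])
      fix s assume "s \<in> {0..t}"
      with t have s: "s \<in> {0..T}" by auto
      have "0 \<le> c * exp (- a * T) * G s" using G_nonneg[OF s] c by simp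
      with F'_le[OF s] show "0 \<le> - F' s" by linarith
    qed
    have "E t \<le> E t + b / a" using a b by simp
    also have "\<dots> = exp (a * t) * F t" by (simp add: F_def exp_minus)
    also have "\<dots> \<le> exp (a * T) * F 0"
      using \<open>0 \<le> - (F t - F 0)\<close> t a F_nonneg[OF t] by (intro mult_mono) auto
    finally show ?thesis by (simp add: F0)
  qed
  have T': "T \<in> {0..T}" using T by simp
  have "c * exp (- a * T) * integral {0..T} G \<le> - (F T - F 0)"
  proof (rule has_integral_le)
    show "((\<lambda>t. c * exp (- a * T) * G t) has_integral c * exp (- a * T) * integral {0..T} G) {0..T}"
      using G_int by (intro has_integral_mult_right integrable_integral)
    show "((\<lambda>t. - F' t) has_integral - (F T - F 0)) {0..T}"
      using FTC[OF T'] by (rule has_integral_neg)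
  qed (rule F'_le)
  also have "\<dots> \<le> F 0" using F_nonneg[OF T'] by simp
  finally show "integral {0..T} G \<le> exp (a * T) / c * (E 0 + b / a)"
    unfolding F0 using c by (simp add: exp_minus field_simps)
qed

text \<open>The inflow datum \<open>u1D\<close> drives the system even from zero initial values: u1
  then starts with slope - Bi H u1D, so no multiple of \<open>E 0\<close> bounds E. Hence
  \<open>Cbar\<close> may depend on a lower bound \<open>m\<close> for \<open>E 0\<close>, while it
  is chosen before the data, projections and grid.\<close>

theorem lemma7:
  fixes L l T d1 d2 d3 Bi H u1D k cbar M3 M4 m :: real
    and \<alpha> \<beta> R Q :: "real \<Rightarrow> real"
  assumes "0 < L" "0 < l" "0 < T"
    and "0 < d1" "0 < d2" "0 < d3" "0 < Bi" "0 < H" "0 < u1D"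
    and "Linf_plus_on {0<..<l} \<alpha>" "bounded (\<alpha> ` {0..l})"
    and "Linf_plus_on {0<..<l} \<beta>" "bounded (\<beta> ` {0..l})"
    and "0 < k" "\<forall>r s. 0 \<le> eta k R Q r s"
    and "\<exists>K. K-lipschitz_on UNIV (\<lambda>(r, s). eta k R Q r s)"
    and "\<forall>r. R r \<le> r"
    and "0 < cbar" "\<forall>s. Q s \<le> cbar"
    and "0 < M3" "W1inf_on {0<..<M3} R" "strict_mono_on {0<..<M3} R"
    and "0 < M4" "W1inf_on {0<..<M4} Q"
    and "mono_on {0<..<M4} Q \<or> antimono_on {0<..<M4} Q"
    and "0 < m"
  shows "\<exists>Cbar > 0. \<forall>U10 u20 u30 u40 P1 P2 Nx Ny u1 u2 u3 u4.
    initial_data L l U10 u20 u30 u40 \<longrightarrow>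
    0 < Nx \<longrightarrow> 0 < Ny \<longrightarrow>
    P1 Nx (\<lambda>x. U10 x - u1D) 0 = 0 \<longrightarrow>
    semi_discrete_solution L l T d1 d2 d3 Bi H u1D \<alpha> \<beta> (eta k R Q) Nx Ny
      (P1 Nx (\<lambda>x. U10 x - u1D)) (P2 Nx Ny u20) (P2 Nx Ny u30) (P1 Nx u40) u1 u2 u3 u4 \<longrightarrow>
    (let hx = L / real Nx; hy = l / real Ny;
         E = (\<lambda>t. total_normsq hx hy Nx Ny (u1 t) (u2 t) (u3 t) (u4 t));
         G = (\<lambda>t. total_grad_normsq hx hy Nx Ny (u1 t) (u2 t) (u3 t));
         C = Cbar * E 0
     in m \<le> E 0 \<longrightarrow>
        (\<forall>t\<in>{0..T}. E t \<le> C) \<and> G integrable_on {0..T} \<and> integral {0..T} G \<le> C)"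
proof -
  obtain K where lip: "K-lipschitz_on UNIV (\<lambda>(r, s). eta k R Q r s)" using assms(16) by blast
  have K: "0 \<le> K" using lip by (rule lipschitz_on_nonneg)
  \<comment> \<open>Nodes form a null set, so an essential bound would not do; the representatives
    are bounded at every point of the closed interval.\<close>
  obtain A1 where A1: "\<And>y. y \<in> {0..l} \<Longrightarrow> \<bar>\<alpha> y\<bar> \<le> A1"
    using assms(11) unfolding bounded_iff by fastforce
  obtain A2 where A2: "\<And>y. y \<in> {0..l} \<Longrightarrow> \<bar>\<beta> y\<bar> \<le> A2"
    using assms(13) unfolding bounded_iff by fastforce
  define A where "A = max A1 A2"
  have "0 \<le> A" using A1[of 0] \<open>0 < l\<close> by (auto simp: A_def)
  define d where "d = Min {d1, d2, d3}"
  have d: "0 < d" "d \<le> d1" "d \<le> d2" "d \<le> d3" using assms(4-6) by (auto simp: d_def)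
  define a where "a = Bi * (H + 1)\<^sup>2 + 4 * A + 2 * K"
  define b where "b = L * (Bi * ((H\<^sup>2 + H) * u1D\<^sup>2))"
  have a: "0 < a" unfolding a_def using \<open>0 < Bi\<close> \<open>0 < H\<close> \<open>0 \<le> A\<close> K
    by (intro add_pos_nonneg mult_pos_pos) auto
  have b: "0 \<le> b" unfolding b_def using \<open>0 < L\<close> \<open>0 < Bi\<close> \<open>0 < H\<close> by simp
  \<comment> \<open>From m \<le> E 0 follows E 0 + b / a \<le> (1 + b / (a m)) E 0.\<close>
  define M where "M = exp (a * T) * (1 + b / (a * m))"
  \<comment> \<open>The maximum serves both claims: 1 for the energy, 1 / (2 d) for the
    gradients.\<close>
  define Cbar where "Cbar = M * max 1 (1 / (2 * d))"
  have M: "0 < M" unfolding M_def using a b \<open>0 < m\<close> by (intro mult_pos_pos add_pos_nonneg) auto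
  have estimate: "(\<forall>t\<in>{0..T}. E t \<le> Cbar * E 0) \<and> G integrable_on {0..T} \<and>
      integral {0..T} G \<le> Cbar * E 0"
    if N: "0 < Nx" "0 < Ny"
      and sol: "semi_discrete_solution L l T d1 d2 d3 Bi H u1D \<alpha> \<beta> (eta k R Q) Nx Ny
        g1 g2 g3 g4 u1 u2 u3 u4"
      and hx: "hx = L / real Nx" and hy: "hy = l / real Ny"
      and E: "E = (\<lambda>t. total_normsq hx hy Nx Ny (u1 t) (u2 t) (u3 t) (u4 t))"
      and G: "G = (\<lambda>t. total_grad_normsq hx hy Nx Ny (u1 t) (u2 t) (u3 t))"
      and m: "m \<le> E 0"
    for Nx Ny g1 g2 g3 g4 u1 u2 u3 u4 hx hy E G
  proof -
    have h: "0 < hx" "0 < hy" using N \<open>0 < L\<close> \<open>0 < l\<close> by (simp_all add: hx hy)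
    note sol' = sol[unfolded semi_discrete_solution_def Let_def, folded hx hy]
    define D1 where "D1 t i = (if i = 0 then 0
      else d1 * lap_h hx (u1 t) i - Bi * (H * (u1 t i + u1D) - u2 t i 0))" for t i
    define D2 where "D2 t i j = d2 * lap_yh hy (u2 t) i j
      - zeta \<alpha> \<beta> (of_int j * hy) (u2 t i j) (u3 t i j)" for t i j
    define D3 where "D3 t i j = d3 * lap_yh hy (u3 t) i j
      + zeta \<alpha> \<beta> (of_int j * hy) (u2 t i j) (u3 t i j)" for t i j
    define D4 where "D4 t i = eta k R Q (u3 t i (int Ny)) (u4 t i)" for t i
    have u1_0: "u1 t 0 = 0" if "t \<in> {0..T}" for t
      using sol' that by blast
    have deriv1: "((\<lambda>s. u1 s i) has_real_derivative D1 t i) (at t within {0..T})"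
      if "t \<in> {0..T}" "i \<in> {0..int Nx}" for t i
    \<comment> \<open>The differential equation for u1 is imposed from node 1 on; at node 0 the
      function is constantly zero.\<close>
    proof (cases "i = 0")
      case True
      have "((\<lambda>s. 0) has_real_derivative 0) (at t within {0..T})" by simp
      then have "((\<lambda>s. u1 s 0) has_real_derivative 0) (at t within {0..T})"
        by (rule has_field_derivative_transform_within[where d = 1]) (use that u1_0 in auto)
      then show ?thesis using True by (simp add: D1_def)
    next
      case False
      then have "i \<in> {1..int Nx}" using that by auto
      then show ?thesis using sol' that(1) False by (simp add: D1_def)
    qed
    have deriv2: "((\<lambda>s. u2 s i j) has_real_derivative D2 t i j) (at t within {0..T})"
      and deriv3: "((\<lambda>s. u3 s i j) has_real_derivative D3 t i j) (at t within {0..T})"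
      if "t \<in> {0..T}" "i \<in> {0..int Nx}" "j \<in> {0..int Ny}" for t i j
      unfolding D2_def D3_def using sol' that by blast+
    have deriv4: "((\<lambda>s. u4 s i) has_real_derivative D4 t i) (at t within {0..T})"
      if "t \<in> {0..T}" "i \<in> {0..int Nx}" for t i
      unfolding D4_def using sol' that by blast
    define E' where "E' t = 2 * inner_G hx Nx (u1 t) (D1 t)
      + hx * (\<Sum>i = 0..int Nx. weight Nx i * (2 * inner_G hy Ny (u2 t i) (D2 t i)))
      + hx * (\<Sum>i = 0..int Nx. weight Nx i * (2 * inner_G hy Ny (u3 t i) (D3 t i)))
      + 2 * inner_G hx Nx (u4 t) (D4 t)" for t
    have E': "(E has_real_derivative E' t) (at t within {0..T})" if "t \<in> {0..T}" for t
      unfolding E E'_def total_normsq_def using that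
      by (intro DERIV_add has_derivative_normsq_G has_derivative_normsq_F
          deriv1 deriv2 deriv3 deriv4)
    have nodes: "of_int j * hy \<in> {0..l}" if "j \<in> {0..int Ny}" for j
    proof -
      have "of_int j * hy \<le> real Ny * hy" using that h by (intro mult_right_mono) auto
      moreover have "0 \<le> of_int j * hy" using that h by simp
      moreover have "real Ny * hy = l" using N by (simp add: hy)
      ultimately show ?thesis by simp
    qed
    have le: "E' t \<le> a * E t + b - 2 * d * G t" if t: "t \<in> {0..T}" for t
    proof -
      \<comment> \<open>This removes the last trace of the grid from the constants.\<close>
      have "hx * real Nx = L" using N by (simp add: hx)
      moreover have "E' t \<le> a * E t + hx * real Nx * (Bi * ((H\<^sup>2 + H) * u1D\<^sup>2)) - 2 * d * G t"
        unfolding E'_def D1_def D2_def D3_def D4_def a_def E G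
      proof (rule energy_dissipation[OF h N d \<open>0 < Bi\<close> \<open>0 < H\<close> K])
        show "\<bar>\<alpha> (of_int j * hy)\<bar> \<le> A \<and> \<bar>\<beta> (of_int j * hy)\<bar> \<le> A" if "j \<in> {0..int Ny}" for j
          using A1[OF nodes[OF that]] A2[OF nodes[OF that]] by (auto simp: A_def)
        show "eta k R Q r s \<le> K * \<bar>s\<bar>" for r s
          using lip by (rule eta_le_Lipschitz)
        show "0 \<le> eta k R Q r s" for r s using assms(15) by blast
        show "r < 0 \<or> s < 0 \<Longrightarrow> eta k R Q r s = 0" for r s by (auto simp: eta_def)
      qed (use sol' t in blast)+
      ultimately show ?thesis by (simp add: b_def)
    qed
    have E_nonneg: "0 \<le> E t" for t
      using h by (simp add: E total_normsq_def normsq_G_nonneg normsq_F_nonneg)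
    have G_nonneg: "0 \<le> G t" for t
      using h by (simp add: G total_grad_normsq_def normsq_E_nonneg normsq_H_nonneg)
    have "continuous_on {0..T} G"
      unfolding G total_grad_normsq_def
      by (intro continuous_on_add continuous_on_normsq_E_grad_h continuous_on_normsq_H_grad_yh)
        (rule DERIV_continuous_on, erule deriv1 deriv2 deriv3, assumption+)+
    then have G_int: "G integrable_on {0..T}" by (rule integrable_continuous_interval)
    have c: "0 < 2 * d" using d by simp
    note Gronwall = Gronwall_with_dissipation[OF \<open>0 < T\<close> a b c E' E_nonneg G_nonneg G_int le]
    have "b / a \<le> b / (a * m) * E 0"
      using mult_left_mono[OF m, of "b / (a * m)"] a b \<open>0 < m\<close> by simp
    then have "exp (a * T) * (E 0 + b / a) \<le> exp (a * T) * (E 0 + b / (a * m) * E 0)"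
      by (intro mult_left_mono) auto
    also have "\<dots> = M * E 0" by (simp add: M_def algebra_simps)
    finally have bound: "exp (a * T) * (E 0 + b / a) \<le> M * E 0" .
    have ME: "0 \<le> M * E 0" using M E_nonneg by simp
    have "E t \<le> Cbar * E 0" if "t \<in> {0..T}" for t
    proof -
      have "E t \<le> M * E 0" using Gronwall(1)[OF _ _ that] bound by simp
      also have "\<dots> \<le> (M * E 0) * max 1 (1 / (2 * d))"
        using mult_left_mono[OF max.cobounded1[of 1 "1 / (2 * d)"] ME] by simp
      finally show ?thesis by (simp add: Cbar_def mult_ac)
    qed
    moreover have "integral {0..T} G \<le> Cbar * E 0"
    proof -
      have "integral {0..T} G \<le> exp (a * T) / (2 * d) * (E 0 + b / a)"
        using Gronwall(2) by simp
      also have "\<dots> = (exp (a * T) * (E 0 + b / a)) * (1 / (2 * d))" by simp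
      also have "\<dots> \<le> (M * E 0) * (1 / (2 * d))"
        using bound d by (intro mult_right_mono) auto
      also have "\<dots> \<le> (M * E 0) * max 1 (1 / (2 * d))"
        using ME by (intro mult_left_mono) auto
      finally show ?thesis by (simp add: Cbar_def mult_ac)
    qed
    ultimately show ?thesis using G_int by blast
  qed
  have "0 < Cbar" unfolding Cbar_def using M by (intro mult_pos_pos) auto
  then show ?thesis
  proof (intro exI[of _ Cbar] conjI allI impI)
    fix U10 u20 u30 u40 P1 P2 Nx Ny u1 u2 u3 u4
    assume "initial_data L l U10 u20 u30 u40"
      and N: "0 < Nx" "0 < Ny"
      and "P1 Nx (\<lambda>x. U10 x - u1D) 0 = 0"
      and sol: "semi_discrete_solution L l T d1 d2 d3 Bi H u1D \<alpha> \<beta> (eta k R Q) Nx Ny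
        (P1 Nx (\<lambda>x. U10 x - u1D)) (P2 Nx Ny u20) (P2 Nx Ny u30) (P1 Nx u40) u1 u2 u3 u4"
    show "let hx = L / real Nx; hy = l / real Ny;
         E = (\<lambda>t. total_normsq hx hy Nx Ny (u1 t) (u2 t) (u3 t) (u4 t));
         G = (\<lambda>t. total_grad_normsq hx hy Nx Ny (u1 t) (u2 t) (u3 t));
         C = Cbar * E 0
     in m \<le> E 0 \<longrightarrow>
        (\<forall>t\<in>{0..T}. E t \<le> C) \<and> G integrable_on {0..T} \<and> integral {0..T} G \<le> C"
      unfolding Let_def by (intro impI estimate[OF N sol refl refl refl refl])
  qed
qed

end
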